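(* Let $n,q,k$ be positive integers. Then $$\#\{\pi\in S_{n+q-1}\mid del_q(\pi)=k-1\}=c_q(n,k),\qquad\text{where } c_q(n,k)=q^k\,(q-1)!\,c(n,k)$$ and $c(n,k)$ is the signless Stirling number of the first kind.
   Context: Let $m=n+q-1$. Permutations in $S_m$ are multiplied as functions: $(\sigma\tau)(i)=\sigma(\tau(i))$; $s_i=(i,i+1)$. Canonical presentation: for $1\le j\le m-1$ let $R_j=\{1,\ s_j,\ s_js_{j-1},\ \ldots,\ s_js_{j-1}\cdots s_1\}$. Every $w\in S_m$ can be written uniquely as $w=w_1\cdots w_{m-1}$ with $w_j\in R_j$; this product, regarded as a word in the $s_i$ (each $w_j$ being spelled as displayed), is the canonical presentation of $w$. $del_q(\pi)$ is the number of times $s_q$ appears in the canonical presentation of $\pi$. *)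

theory Defs
  imports "HOL-Combinatorics.Permutations" "HOL-Combinatorics.Stirling"
begin

text \<open>
  The symmetric group on m letters consists of the functions \<open>\<pi> :: nat \<Rightarrow> nat\<close> with
  \<open>\<pi> permutes {1..m}\<close>; its product is composition of functions.
\<close>

definition adj_transp :: "nat \<Rightarrow> (nat \<Rightarrow> nat)" where
  "adj_transp i = transpose i (i + 1)"

text \<open>
  A word in the generators is the list of its indices, so that \<open>[a, b, c]\<close> stands for
  the product of the adjacent transpositions with these indices, in this order.
\<close>

definition word_perm :: "nat list \<Rightarrow> (nat \<Rightarrow> nat)" where
  "word_perm ws = foldr (\<lambda>i \<sigma>. adj_transp i \<circ> \<sigma>) ws id"

text \<open>
  The elements of \<open>R\<^sub>j\<close>, each spelled as a word: \<open>rev [i..<j + 1]\<close> is \<open>[j, j - 1, \<dots>, i]\<close>,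
  and \<open>i = j + 1\<close> gives the empty word.
\<close>

definition R_words :: "nat \<Rightarrow> nat list set" where
  "R_words j = {rev [i..<j + 1] | i. 1 \<le> i \<and> i \<le> j + 1}"

text \<open>
  The list \<open>bs\<close> holds the factors \<open>w\<^sub>1, \<dots>, w\<^sub>m\<^sub>-\<^sub>1\<close>; lists are indexed from 0, hence the
  shift in the index.
\<close>

definition canonical_factorization :: "nat \<Rightarrow> (nat \<Rightarrow> nat) \<Rightarrow> nat list list \<Rightarrow> bool" where
  "canonical_factorization m w bs \<longleftrightarrow>
     length bs = m - 1 \<and>
     (\<forall>j\<in>{1..m - 1}. bs ! (j - 1) \<in> R_words j) \<and>
     word_perm (concat bs) = w"

definition canonical_presentation :: "nat \<Rightarrow> (nat \<Rightarrow> nat) \<Rightarrow> nat list" where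
  "canonical_presentation m w = concat (THE bs. canonical_factorization m w bs)"

definition del :: "nat \<Rightarrow> nat \<Rightarrow> (nat \<Rightarrow> nat) \<Rightarrow> nat" where
  "del q m \<pi> = count_list (canonical_presentation m \<pi>) q"

text \<open>The library's \<open>stirling\<close> is the signless Stirling number of the first kind.\<close>

definition c_q :: "nat \<Rightarrow> nat \<Rightarrow> nat \<Rightarrow> nat" where
  "c_q q n k = q ^ k * fact (q - 1) * stirling n k"

end

theory Submission
  imports Defs
begin

text \<open>
  A canonical presentation is a free choice of one word from each \<open>R\<^sub>j\<close>. The words in \<open>R\<^sub>j\<close> are
  \<open>s\<^sub>j \<cdots> s\<^sub>i\<close> with \<open>1 \<le> i \<le> j + 1\<close>, and such a word contains \<open>s\<^sub>q\<close> once if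
  \<open>i \<le> q \<le> j\<close> and not at all otherwise. Thus for \<open>j < q\<close> all \<open>j + 1\<close> words avoid \<open>s\<^sub>q\<close>, while
  for \<open>j \<ge> q\<close> there are \<open>q\<close> words with one \<open>s\<^sub>q\<close> and \<open>j + 1 - q\<close> words without. The generating
  function of \<open>del\<^sub>q\<close> over \<open>S\<^bsub>n+q-1\<^esub>\<close> is therefore
  \<open>q! \<Prod>\<^bsub>1\<le>l<n\<^esub> (q x + l)\<close>. Since \<open>y \<Prod>\<^bsub>1\<le>l<n\<^esub> (y + l) = \<Sum>\<^sub>k c(n,k) y\<^sup>k\<close>, its coefficient
  at \<open>x\<^bsup>k-1\<^esup>\<close> is \<open>q! q\<^bsup>k-1\<^esup> c(n,k) = q\<^sup>k (q-1)! c(n,k)\<close>.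

  Two facts carry this out. By \<open>word_perm_bij_betw_factorizations\<close> the permutations correspond to
  the sequences of choices. Appending one more block then gives the recurrence
  \<open>card_occurrences_Suc\<close>, which is the recurrence of the Stirling numbers with weight \<open>q\<close> on one
  of its two terms; \<open>card_occurrences\<close> solves it by induction on \<open>n\<close>.
\<close>

section \<open>The words in R\<close>

lemma word_perm_simps [simp]:
  "word_perm [] = id"
  "word_perm (a # ws) = adj_transp a \<circ> word_perm ws"
  by (simp_all add: word_perm_def)

lemma word_perm_append: "word_perm (us @ vs) = word_perm us \<circ> word_perm vs"
  by (induction us) (simp_all add: comp_assoc)

lemma word_perm_permutes:
  assumes "set ws \<subseteq> {1..N}"
  shows "word_perm ws permutes {1..Suc N}"
  using assms
proof (induction ws)
  case Nil
  show ?case unfolding word_perm_simps by (rule permutes_id)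
next
  case (Cons a ws)
  have "adj_transp a permutes {1..Suc N}"
    unfolding adj_transp_def using Cons.prems by (intro permutes_swap_id) auto
  moreover have "word_perm ws permutes {1..Suc N}"
    using Cons by simp
  ultimately show ?case
    unfolding word_perm_simps by (intro permutes_compose)
qed

text \<open>
  Read from right to left, the word \<open>s\<^sub>j \<cdots> s\<^sub>i\<close> carries \<open>i\<close> upwards one step at a time to
  \<open>j + 1\<close>. This is what makes the last block of a factorization recoverable from the product.
\<close>

lemma word_perm_descending:
  assumes "i \<le> j + 1"
  shows "word_perm (rev [i..<j + 1]) i = j + 1"
proof -
  have "word_perm (rev [i..<i + d]) i = i + d" for d
    by (induction d) (simp_all add: adj_transp_def)
  from this[of "j + 1 - i"] assms show ?thesis by simp
qed

lemma R_words_eq_image: "R_words j = (\<lambda>i. rev [i..<j + 1]) ` {1..j + 1}"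
  by (auto simp: R_words_def)

lemma inj_on_descending: "inj_on (\<lambda>i. rev [i..<j + 1]) {1..j + 1}"
proof (rule inj_onI)
  fix i i' assume "i \<in> {1..j + 1}" "i' \<in> {1..j + 1}" "rev [i..<j + 1] = rev [i'..<j + 1]"
  moreover from this(3) have "j + 1 - i = j + 1 - i'"
    by (metis length_rev length_upt)
  ultimately show "i = i'" by auto
qed

lemma finite_R_words: "finite (R_words j)"
  by (simp add: R_words_eq_image)

lemma word_perm_R_words_permutes:
  assumes "b \<in> R_words j"
  shows "word_perm b permutes {1..Suc j}"
  using assms by (intro word_perm_permutes) (auto simp: R_words_def)

lemma count_list_descending:
  "count_list (rev [i..<j + 1]) q = (if i \<le> q \<and> q \<le> j then 1 else 0)"
proof -
  have "count_list [i..<j + 1] q = (if i \<le> q \<and> q \<le> j then 1 else 0)"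
    by (induction j) (auto simp: count_notin)
  then show ?thesis by (simp only: count_list_rev)
qed

lemma card_R_words_filter:
  "card {b \<in> R_words j. P b} = card {i \<in> {1..j + 1}. P (rev [i..<j + 1])}"
proof -
  have "{b \<in> R_words j. P b} = (\<lambda>i. rev [i..<j + 1]) ` {i \<in> {1..j + 1}. P (rev [i..<j + 1])}"
    by (auto simp: R_words_eq_image)
  moreover have "inj_on (\<lambda>i. rev [i..<j + 1]) {i \<in> {1..j + 1}. P (rev [i..<j + 1])}"
    by (rule inj_on_subset[OF inj_on_descending]) auto
  ultimately show ?thesis by (simp only: card_image)
qed

lemma card_R_words_containing:
  assumes "q \<le> j"
  shows "card {b \<in> R_words j. count_list b q = 1} = q"
proof -
  have "{i \<in> {1..j + 1}. count_list (rev [i..<j + 1]) q = 1} = {1..q}"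
    unfolding count_list_descending using assms by auto
  then show ?thesis by (simp add: card_R_words_filter del: upt_Suc One_nat_def)
qed

lemma card_R_words_avoiding:
  assumes "q \<le> j"
  shows "card {b \<in> R_words j. count_list b q = 0} = j + 1 - q"
proof -
  have "{i \<in> {1..j + 1}. count_list (rev [i..<j + 1]) q = 0} = {q + 1..j + 1}"
    unfolding count_list_descending using assms by auto
  then show ?thesis by (simp add: card_R_words_filter del: upt_Suc One_nat_def)
qed

lemma count_list_R_words_le_1:
  assumes "b \<in> R_words j"
  shows "count_list b q \<le> 1"
  using assms unfolding R_words_eq_image
  by (auto simp only: count_list_descending split: if_splits)

section \<open>Factorizations and permutations\<close>

text \<open>
  The sequences of choices are indexed by the number \<open>N\<close> of blocks, so they belong to \<open>S\<^bsub>N+1\<^esub>\<close>;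
  this keeps truncated subtraction out of the inductions.
\<close>

definition factorizations :: "nat \<Rightarrow> nat list list set" where
  "factorizations N = {bs. length bs = N \<and> (\<forall>j\<in>{1..N}. bs ! (j - 1) \<in> R_words j)}"

lemma factorizations_0: "factorizations 0 = {[]}"
  by (auto simp: factorizations_def)

lemma snoc_in_factorizations_iff:
  "bs @ [b] \<in> factorizations (Suc N) \<longleftrightarrow> bs \<in> factorizations N \<and> b \<in> R_words (Suc N)"
proof (cases "length bs = N")
  case True
  have "{1..Suc N} = insert (Suc N) {1..N}" by auto
  moreover have "(bs @ [b]) ! (j - 1) = bs ! (j - 1)" if "j \<in> {1..N}" for j
    using that True by (auto simp: nth_append)
  ultimately show ?thesis using True by (auto simp: factorizations_def nth_append)
next
  case False
  then show ?thesis by (simp add: factorizations_def)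
qed

lemma factorizations_Suc:
  "factorizations (Suc N) = (\<lambda>(bs, b). bs @ [b]) ` (factorizations N \<times> R_words (Suc N))"
proof (intro equalityI subsetI)
  fix cs assume cs: "cs \<in> factorizations (Suc N)"
  then have "cs \<noteq> []" by (auto simp: factorizations_def)
  then have "cs = butlast cs @ [last cs]" by simp
  with cs show "cs \<in> (\<lambda>(bs, b). bs @ [b]) ` (factorizations N \<times> R_words (Suc N))"
    using snoc_in_factorizations_iff[of "butlast cs" "last cs" N] by force
qed (auto simp: snoc_in_factorizations_iff)

lemma factorizations_SucE:
  assumes "cs \<in> factorizations (Suc N)"
  obtains bs i where "bs \<in> factorizations N" "i \<in> {1..Suc N + 1}"
    "cs = bs @ [rev [i..<Suc N + 1]]"
  using assms unfolding factorizations_Suc R_words_eq_image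
  by (auto simp del: upt_Suc One_nat_def)

lemma finite_factorizations: "finite (factorizations N)"
  by (induction N) (simp_all add: factorizations_0 factorizations_Suc finite_R_words)

lemma word_perm_factorization_permutes:
  assumes "bs \<in> factorizations N"
  shows "word_perm (concat bs) permutes {1..Suc N}"
  using assms
proof (induction N arbitrary: bs)
  case 0
  then have "concat bs = []" by (simp add: factorizations_0)
  then show ?case by (simp only: word_perm_simps permutes_id)
next
  case (Suc N)
  then obtain bs' b where bs: "bs = bs' @ [b]"
    and bs': "bs' \<in> factorizations N" and b: "b \<in> R_words (Suc N)"
    by (auto simp: factorizations_Suc)
  have "word_perm (concat bs') permutes {1..Suc (Suc N)}"
    by (rule permutes_subset[OF Suc.IH[OF bs']]) auto
  moreover have "concat bs = concat bs' @ b" by (simp add: bs)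
  ultimately show ?case
    by (simp only: word_perm_append permutes_compose word_perm_R_words_permutes[OF b])
qed

text \<open>
  The blocks before the last one fix \<open>N + 2\<close>, so the last block is determined by the
  product: its index \<open>i\<close> is the preimage of \<open>N + 2\<close>.
\<close>

lemma word_perm_snoc_index:
  assumes "bs \<in> factorizations N" and "i \<le> Suc N + 1"
  shows "word_perm (concat (bs @ [rev [i..<Suc N + 1]])) i = Suc N + 1"
proof -
  have "word_perm (concat bs) (Suc N + 1) = Suc N + 1"
    using permutes_not_in[OF word_perm_factorization_permutes[OF assms(1)]] by simp
  moreover have "word_perm (rev [i..<Suc N + 1]) i = Suc N + 1"
    by (rule word_perm_descending) (use assms(2) in simp)
  ultimately show ?thesis by (simp only: concat_append word_perm_append) (simp del: upt_Suc)
qed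

lemma inj_on_word_perm_factorizations:
  "inj_on (\<lambda>bs. word_perm (concat bs)) (factorizations N)"
proof (induction N)
  case 0
  show ?case by (simp add: factorizations_0)
next
  case (Suc N)
  show ?case
  proof (rule inj_onI)
    fix cs ds
    assume cs: "cs \<in> factorizations (Suc N)" and ds: "ds \<in> factorizations (Suc N)"
      and eq: "word_perm (concat cs) = word_perm (concat ds)"
    from cs obtain bs i where bs: "bs \<in> factorizations N" "i \<in> {1..Suc N + 1}"
      "cs = bs @ [rev [i..<Suc N + 1]]"
      by (rule factorizations_SucE)
    from ds obtain bs' i' where bs': "bs' \<in> factorizations N" "i' \<in> {1..Suc N + 1}"
      "ds = bs' @ [rev [i'..<Suc N + 1]]"
      by (rule factorizations_SucE)
    have "word_perm (concat cs) i = Suc N + 1"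
      unfolding bs(3) by (rule word_perm_snoc_index) (use bs in auto)
    moreover have "word_perm (concat ds) i' = Suc N + 1"
      unfolding bs'(3) by (rule word_perm_snoc_index) (use bs' in auto)
    ultimately have "word_perm (concat cs) i = word_perm (concat cs) i'" by (simp only: eq)
    then have i: "i = i'"
      using permutes_inj[OF word_perm_factorization_permutes[OF cs]] by (simp add: inj_eq)
    define b where "b = rev [i..<Suc N + 1]"
    have "b \<in> R_words (Suc N)"
      using bs(2) by (simp add: b_def R_words_eq_image del: upt_Suc)
    then have surj: "surj (word_perm b)"
      by (rule permutes_surj[OF word_perm_R_words_permutes])
    have "word_perm (concat bs) \<circ> word_perm b = word_perm (concat bs') \<circ> word_perm b"
      using eq unfolding bs(3) bs'(3) i[symmetric] b_def[symmetric]
      by (simp add: word_perm_append)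
    then have "word_perm (concat bs) = word_perm (concat bs')"
      using surj by (metis comp_def surjD ext)
    then have "bs = bs'" using Suc.IH bs(1) bs'(1) by (auto dest: inj_onD)
    then show "cs = ds" by (simp add: bs(3) bs'(3) i)
  qed
qed

text \<open>
  Cancelling the block determined by the preimage of \<open>N + 2\<close> leaves a permutation that fixes
  \<open>N + 2\<close>, so a factorization exists by induction.
\<close>

lemma ex_factorization:
  assumes "\<pi> permutes {1..Suc N}"
  shows "\<exists>bs \<in> factorizations N. word_perm (concat bs) = \<pi>"
  using assms
proof (induction N arbitrary: \<pi>)
  case 0
  then show ?case by (simp add: factorizations_0)
next
  case (Suc N)
  have "Suc N + 1 \<in> \<pi> ` {1..Suc N + 1}"
    using permutes_image[OF Suc.prems] by simp
  then obtain i where i: "i \<in> {1..Suc N + 1}" "\<pi> i = Suc N + 1"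
    by (metis imageE)
  define b where "b = rev [i..<Suc N + 1]"
  have b: "b \<in> R_words (Suc N)"
    using i(1) by (simp add: b_def R_words_eq_image del: upt_Suc)
  then have perm_b: "word_perm b permutes {1..Suc (Suc N)}"
    by (rule word_perm_R_words_permutes)
  have b_i: "word_perm b i = Suc N + 1"
    unfolding b_def by (rule word_perm_descending) (use i(1) in simp)
  define \<rho> where "\<rho> = \<pi> \<circ> inv (word_perm b)"
  have "\<rho> permutes {1..Suc (Suc N)}"
    unfolding \<rho>_def by (intro permutes_compose permutes_inv perm_b Suc.prems)
  moreover have "\<rho> (Suc N + 1) = Suc N + 1"
    using i(2) b_i permutes_inverses(2)[OF perm_b, of i] by (simp add: \<rho>_def)
  then have "\<rho> x = x" if "x \<in> {1..Suc (Suc N)} - {1..Suc N}" for x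
  proof -
    have "x = Suc N + 1" using that by auto
    with \<open>\<rho> (Suc N + 1) = Suc N + 1\<close> show ?thesis by simp
  qed
  ultimately have "\<rho> permutes {1..Suc N}"
    by (rule permutes_superset)
  then obtain bs where bs: "bs \<in> factorizations N" "word_perm (concat bs) = \<rho>"
    using Suc.IH by blast
  have "word_perm (concat (bs @ [b])) = \<rho> \<circ> word_perm b"
    by (simp add: word_perm_append bs(2))
  also have "\<dots> = \<pi>"
    using permutes_inverses(2)[OF perm_b] by (simp add: \<rho>_def fun_eq_iff)
  finally show ?case using bs(1) b snoc_in_factorizations_iff by blast
qed

lemma word_perm_bij_betw_factorizations:
  "bij_betw (\<lambda>bs. word_perm (concat bs)) (factorizations N) {\<pi>. \<pi> permutes {1..Suc N}}"
proof (rule bij_betw_imageI[OF inj_on_word_perm_factorizations])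
  show "(\<lambda>bs. word_perm (concat bs)) ` factorizations N = {\<pi>. \<pi> permutes {1..Suc N}}"
    using word_perm_factorization_permutes ex_factorization by blast
qed

lemma canonical_presentation_word_perm:
  assumes "bs \<in> factorizations N"
  shows "canonical_presentation (Suc N) (word_perm (concat bs)) = concat bs"
proof -
  have "canonical_factorization (Suc N) (word_perm (concat bs)) cs \<longleftrightarrow> cs = bs" for cs
  proof -
    have "canonical_factorization (Suc N) (word_perm (concat bs)) cs \<longleftrightarrow>
        cs \<in> factorizations N \<and> word_perm (concat cs) = word_perm (concat bs)"
      by (auto simp: canonical_factorization_def factorizations_def)
    then show ?thesis
      using inj_onD[OF inj_on_word_perm_factorizations] assms by blast
  qed
  then show ?thesis by (simp add: canonical_presentation_def)
qed

section \<open>Counting by occurrences\<close>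

definition occurrences :: "nat \<Rightarrow> nat \<Rightarrow> nat \<Rightarrow> nat list list set" where
  "occurrences q N r = {bs \<in> factorizations N. count_list (concat bs) q = r}"

lemma finite_occurrences: "finite (occurrences q N r)"
  by (simp add: occurrences_def finite_factorizations)

lemma card_del_eq_card_occurrences:
  "card {\<pi>. \<pi> permutes {1..Suc N} \<and> del q (Suc N) \<pi> = r} = card (occurrences q N r)"
proof -
  let ?f = "\<lambda>bs. word_perm (concat bs)"
  have del: "del q (Suc N) (?f bs) = count_list (concat bs) q" if "bs \<in> factorizations N" for bs
    using that by (simp add: del_def canonical_presentation_word_perm)
  have "{\<pi>. \<pi> permutes {1..Suc N}} = ?f ` factorizations N"
    using word_perm_bij_betw_factorizations by (simp add: bij_betw_def)
  then have "{\<pi>. \<pi> permutes {1..Suc N} \<and> del q (Suc N) \<pi> = r} =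
      {\<pi> \<in> ?f ` factorizations N. del q (Suc N) \<pi> = r}"
    by blast
  also have "\<dots> = ?f ` occurrences q N r"
    by (auto simp: occurrences_def del)
  finally have "{\<pi>. \<pi> permutes {1..Suc N} \<and> del q (Suc N) \<pi> = r} = ?f ` occurrences q N r" .
  moreover have "inj_on ?f (occurrences q N r)"
    by (rule inj_on_subset[OF inj_on_word_perm_factorizations]) (auto simp: occurrences_def)
  ultimately show ?thesis by (simp add: card_image)
qed

text \<open>
  Blocks below \<open>q\<close> consist of letters smaller than \<open>q\<close>, so each of the \<open>(N + 1)!\<close>
  factorizations avoids \<open>s\<^sub>q\<close>.
\<close>

lemma card_occurrences_small:
  assumes "N < q"
  shows "card (occurrences q N r) = (if r = 0 then fact (Suc N) else 0)"
proof -
  have "count_list (concat bs) q = 0" if "bs \<in> factorizations N" for bs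
    using that assms
  proof (induction N arbitrary: bs)
    case 0
    then show ?case by (simp add: factorizations_0)
  next
    case (Suc N)
    then obtain bs' i where "bs' \<in> factorizations N" "bs = bs' @ [rev [i..<Suc N + 1]]"
      using factorizations_SucE[OF Suc.prems(1)] by metis
    with Suc show ?case
      by (simp add: count_list_descending[of i "Suc N", simplified] del: upt_Suc)
  qed
  then have "occurrences q N r = (if r = 0 then factorizations N else {})"
    by (auto simp: occurrences_def)
  moreover have "card (factorizations N) = fact (Suc N)"
    using bij_betw_same_card[OF word_perm_bij_betw_factorizations[of N]]
    by (simp add: card_permutations)
  ultimately show ?thesis by simp
qed

text \<open>
  A new block \<open>R\<^bsub>N+1\<^esub>\<close> with \<open>N + 1 \<ge> q\<close> offers \<open>N + 2 - q\<close> words without \<open>s\<^sub>q\<close> and \<open>q\<close> words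
  with one \<open>s\<^sub>q\<close>.
\<close>

lemma card_occurrences_Suc:
  assumes "q \<le> Suc N"
  shows "card (occurrences q (Suc N) r) = (N + 2 - q) * card (occurrences q N r) +
    (if r = 0 then 0 else q * card (occurrences q N (r - 1)))"
proof -
  define snoc :: "nat list list \<times> nat list \<Rightarrow> nat list list" where "snoc = (\<lambda>(bs, b). bs @ [b])"
  define B where "B e = {b \<in> R_words (Suc N). count_list b q = e}" for e
  \<comment> \<open>For \<open>r = 0\<close> truncated subtraction would turn \<open>r - 1\<close> into \<open>0\<close>; no factorization has \<open>-1\<close> occurrences.\<close>
  define A where "A = (if r = 0 then {} else occurrences q N (r - 1))"
  have fin: "finite (occurrences q N r)" "finite A" "finite (B e)" for e
    by (auto simp: A_def B_def finite_occurrences finite_R_words)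
  have B_cases: "b \<in> B 0 \<or> b \<in> B 1" if "b \<in> R_words (Suc N)" for b
    using count_list_R_words_le_1[OF that, of q] that by (auto simp: B_def le_Suc_eq)
  have "occurrences q (Suc N) r = snoc ` (occurrences q N r \<times> B 0 \<union> A \<times> B 1)"
  proof (intro equalityI subsetI)
    fix cs assume "cs \<in> occurrences q (Suc N) r"
    then obtain bs b where cs: "cs = bs @ [b]" "bs \<in> factorizations N" "b \<in> R_words (Suc N)"
      "count_list (concat bs) q + count_list b q = r"
      by (auto simp: occurrences_def factorizations_Suc)
    with B_cases[of b] have "(bs, b) \<in> occurrences q N r \<times> B 0 \<union> A \<times> B 1"
      by (auto simp: occurrences_def A_def B_def)
    then show "cs \<in> snoc ` (occurrences q N r \<times> B 0 \<union> A \<times> B 1)"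
      by (rule rev_image_eqI) (simp add: cs snoc_def)
  next
    fix cs assume "cs \<in> snoc ` (occurrences q N r \<times> B 0 \<union> A \<times> B 1)"
    then show "cs \<in> occurrences q (Suc N) r"
      by (auto simp: snoc_def occurrences_def A_def B_def snoc_in_factorizations_iff
          split: if_splits)
  qed
  moreover have "inj_on snoc (occurrences q N r \<times> B 0 \<union> A \<times> B 1)"
    by (auto simp: snoc_def inj_on_def)
  ultimately have "card (occurrences q (Suc N) r) = card (occurrences q N r \<times> B 0 \<union> A \<times> B 1)"
    by (simp add: card_image)
  also have "\<dots> = card (occurrences q N r) * card (B 0) + card A * card (B 1)"
    by (subst card_Un_disjoint) (use fin in \<open>auto simp: B_def card_cartesian_product\<close>)
  also have "card (B 0) = N + 2 - q"
    using card_R_words_avoiding[OF assms] by (simp add: B_def)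
  also have "card (B 1) = q"
    using card_R_words_containing[OF assms] by (simp only: B_def)
  finally show ?thesis by (simp add: A_def mult.commute)
qed

text \<open>
  With \<open>N = n + p\<close> blocks and \<open>q = p + 1\<close>, the factor \<open>N + 2 - q\<close> of the recurrence
  is the factor \<open>n + 1\<close> in the recurrence of the Stirling numbers. The start \<open>n = 0\<close>
  accounts for the \<open>q!\<close> choices of the blocks below \<open>q\<close>.
\<close>

lemma card_occurrences:
  "card (occurrences (Suc p) (n + p) r) = Suc p ^ Suc r * fact p * stirling (Suc n) (Suc r)"
proof (induction n arbitrary: r)
  case 0
  show ?case by (simp add: card_occurrences_small)
next
  case (Suc n)
  have "card (occurrences (Suc p) (Suc (n + p)) r) = Suc n * card (occurrences (Suc p) (n + p) r) +
    (if r = 0 then 0 else Suc p * card (occurrences (Suc p) (n + p) (r - 1)))"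
    by (subst card_occurrences_Suc) simp_all
  also have "\<dots> = Suc p ^ Suc r * fact p *
      (Suc n * stirling (Suc n) (Suc r) + stirling (Suc n) r)"
  proof (cases r)
    case 0
    then show ?thesis by (simp add: Suc.IH algebra_simps del: stirling.simps)
  next
    case (Suc r')
    then show ?thesis
      by (simp only: Suc.IH if_False nat.simps diff_Suc_1 power_Suc) (simp add: algebra_simps)
  qed
  finally show ?case by simp
qed

theorem proposition2p9:
  fixes n q k :: nat
  assumes "n \<ge> 1" and "q \<ge> 1" and "k \<ge> 1"
  shows "card {\<pi>. \<pi> permutes {1..n + q - 1} \<and> del q (n + q - 1) \<pi> = k - 1} = c_q q n k"
proof -
  obtain n' p r where [simp]: "n = Suc n'" "q = Suc p" "k = Suc r"
    using assms by (cases n; cases q; cases k) auto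
  have "n + q - 1 = Suc (n' + p)" by simp
  then show ?thesis
    by (simp only: card_del_eq_card_occurrences) (simp add: card_occurrences c_q_def)
qed

end
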